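(* Let $X$ be an orientable map whose automorphism group acts transitively on the vertex set $V$, and let $u,v$ be vertices of $X$. Then: (i) if $u\neq v$ and there is perfect state transfer from $u$ to $v$ at time $\tau$, then for every vertex $x$ there is a unique vertex $y$ such that there is perfect state transfer from $x$ to $y$ at time $\tau$; moreover $U^{2\tau}=I$; (ii) if $X$ is periodic at the vertex $u$ at time $\tau$, then $X$ is periodic at time $\tau$; (iii) if $u\ne v$ and there is perfect state transfer from $u$ to $v$ at time $1$, then $V=\{u,v\}$.
   Context: An orientable map $X$ is a 2-cell embedding of a finite connected multigraph (loops and parallel edges allowed) in a closed orientable surface, with vertex set $V$, edge set $E$, face set $F$. Each edge has four flags, one for each choice of an end of the edge and a side of the edge; a flag is incident to the vertex at its end, to the edge, and to the face on its side. An automorphism of $X$ is a permutation of the flags, together with the induced permutations of $V,E,F$, preserving all incidences between flags, vertices, edges and faces. Each edge gives rise to two arcs (the clockwise flags) on opposite sides of it, pointing in opposite directions; each arc lies in a face and is oriented along the clockwise facial walk of that face. Let $\mathcal A$ be the set of arcs, $v(a)$ the tail vertex and $f(a)$ the face of arc $a$. Let $N\in\{0,1\}^{\mathcal A\times V}$ with $N(a,v)=1$ iff $v=v(a)$, $M\in\{0,1\}^{\mathcal A\times F}$ with $M(a,f)=1$ iff $f=f(a)$, $D=N^TN$, $\Delta=M^TM$, $\hat N=ND^{-1/2}$, $\hat M=M\Delta^{-1/2}$, $Q=\hat N\hat N^T$, $P=\hat M\hat M^T$, $U=(2P-I)(2Q-I)$. For $w\in V$ let $e_w$ be the standard basis vector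 of $\mathbb{C}^V$. For distinct vertices $u,v$ (which here have equal degree by vertex-transitivity), there is perfect state transfer from $u$ to $v$ at time $\tau>0$ if $U^\tau\hat Ne_u=\hat Ne_v$; $X$ is periodic at vertex $u$ at time $\tau$ if $U^\tau\hat Ne_u=\hat Ne_u$; $X$ is periodic at time $\tau$ if $U^\tau\hat N=\hat N$. *)

theory Defs
  imports
    "HOL-Analysis.Analysis"
    "HOL-Combinatorics.Orbits"
    "Graph_Theory.Bidirected_Digraph"
    "Graph_Theory.Digraph_Component"
begin

section \<open>Orientable maps\<close>

text \<open>
  A 2-cell embedding of a finite connected multigraph in a closed oriented surface is given, as
  usual, by a rotation system. The multigraph is a bidirected digraph \<open>G\<close>: every edge is a pair
  \<open>{a, arev a}\<close> of opposite arcs (\<open>arev a \<noteq> a\<close> also for a loop). The arcs with tail \<open>v\<close> are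
  cyclically permuted by \<open>rot\<close>, the order in which the edge ends occur counterclockwise around
  \<open>v\<close>. The face of an arc \<open>a\<close> is the one on its right-hand side; the arc following \<open>a\<close> on the
  clockwise walk around this face is \<open>rot (arev a)\<close>. Hence the faces correspond to the cycles of
  \<open>rot \<circ> arev\<close>; \<open>face\<close> names them by the elements of \<open>'f\<close>.

  The vertices, arcs and faces exhaust finite types, so that they can index matrices. There is at
  least one arc: for a graph without edges the degree matrices below are not invertible.
\<close>

locale orientable_map = bidirected_digraph G arev
  for G :: "('v::finite, 'a::finite) pre_digraph" and arev :: "'a \<Rightarrow> 'a" +
  fixes rot :: "'a \<Rightarrow> 'a" and face :: "'a \<Rightarrow> 'f::finite"
  assumes verts_UNIV: "verts G = UNIV"
    and arcs_UNIV: "arcs G = UNIV"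
    and connected_G: "Digraph_Component.connected G"
    and cyclic_rot: "cyclic_on rot (out_arcs G v)"
    and face_eq_iff: "face a = face b \<longleftrightarrow> a \<in> orbit (rot \<circ> arev) b"
    and surj_face: "surj face"

definition arc_edge :: "('a \<Rightarrow> 'a) \<Rightarrow> 'a \<Rightarrow> 'a set" where
  "arc_edge arev a = {a, arev a}"

text \<open>
  A flag is a pair \<open>(d, s)\<close> of arcs on the same edge: \<open>d\<close> determines the end of the edge (the
  tail of \<open>d\<close>) and \<open>s\<close> the side (the one on which \<open>s\<close> lies). The clockwise flags are the pairs
  \<open>(a, a)\<close>; they are identified with the arcs.
\<close>

definition flags :: "('a \<Rightarrow> 'a) \<Rightarrow> ('a \<times> 'a) set" where
  "flags arev = {(d, s). s \<in> arc_edge arev d}"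

definition flag_vertex :: "('v, 'a) pre_digraph \<Rightarrow> 'a \<times> 'a \<Rightarrow> 'v" where
  "flag_vertex G x = tail G (fst x)"

definition flag_edge :: "('a \<Rightarrow> 'a) \<Rightarrow> 'a \<times> 'a \<Rightarrow> 'a set" where
  "flag_edge arev x = arc_edge arev (fst x)"

definition flag_face :: "('a \<Rightarrow> 'f) \<Rightarrow> 'a \<times> 'a \<Rightarrow> 'f" where
  "flag_face face x = face (snd x)"

text \<open>
  Vertices, edges and faces are incident to each other via common flags, so it suffices to preserve
  the incidences with flags. Automorphisms may reverse the orientation.
\<close>

definition map_automorphism ::
  "('v, 'a) pre_digraph \<Rightarrow> ('a \<Rightarrow> 'a) \<Rightarrow> ('a \<Rightarrow> 'f) \<Rightarrow>
   ('a \<times> 'a \<Rightarrow> 'a \<times> 'a) \<Rightarrow> ('v \<Rightarrow> 'v) \<Rightarrow> ('a set \<Rightarrow> 'a set) \<Rightarrow> ('f \<Rightarrow> 'f) \<Rightarrow> bool" where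
  "map_automorphism G arev face \<phi> \<phi>V \<phi>E \<phi>F \<longleftrightarrow>
     \<phi> permutes flags arev \<and> \<phi>V permutes verts G \<and>
     \<phi>E permutes range (arc_edge arev) \<and> \<phi>F permutes range face \<and>
     (\<forall>x \<in> flags arev.
        flag_vertex G (\<phi> x) = \<phi>V (flag_vertex G x) \<and>
        flag_edge arev (\<phi> x) = \<phi>E (flag_edge arev x) \<and>
        flag_face face (\<phi> x) = \<phi>F (flag_face face x))"

definition vertex_transitive ::
  "('v, 'a) pre_digraph \<Rightarrow> ('a \<Rightarrow> 'a) \<Rightarrow> ('a \<Rightarrow> 'f) \<Rightarrow> bool" where
  "vertex_transitive G arev face \<longleftrightarrow>
     (\<forall>x \<in> verts G. \<forall>y \<in> verts G. \<exists>\<phi> \<phi>V \<phi>E \<phi>F.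
        map_automorphism G arev face \<phi> \<phi>V \<phi>E \<phi>F \<and> \<phi>V x = y)"


section \<open>The vertex-face walk\<close>

definition tail_matrix :: "('v::finite, 'a::finite) pre_digraph \<Rightarrow> complex^'v^'a" where
  "tail_matrix G = (\<chi> a v. if v = tail G a then 1 else 0)"

definition face_matrix :: "('a::finite \<Rightarrow> 'f::finite) \<Rightarrow> complex^'f^'a" where
  "face_matrix face = (\<chi> a f. if f = face a then 1 else 0)"

text \<open>\<open>A\<^sup>-\<^sup>1\<^sup>/\<^sup>2\<close> for a diagonal matrix \<open>A\<close> with positive diagonal entries\<close>

definition diag_inv_sqrt :: "complex^'n^'n \<Rightarrow> complex^'n^'n" where
  "diag_inv_sqrt A = (\<chi> i j. if i = j then 1 / csqrt (A $ i $ i) else 0)"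

definition normalize_columns :: "complex^'n^'m \<Rightarrow> complex^'n^'m" where
  "normalize_columns A = A ** diag_inv_sqrt (transpose A ** A)"

abbreviation N_hat :: "('v::finite, 'a::finite) pre_digraph \<Rightarrow> complex^'v^'a" where
  "N_hat G \<equiv> normalize_columns (tail_matrix G)"

abbreviation M_hat :: "('a::finite \<Rightarrow> 'f::finite) \<Rightarrow> complex^'f^'a" where
  "M_hat face \<equiv> normalize_columns (face_matrix face)"

definition Q_mat :: "('v::finite, 'a::finite) pre_digraph \<Rightarrow> complex^'a^'a" where
  "Q_mat G = N_hat G ** transpose (N_hat G)"

definition P_mat :: "('a::finite \<Rightarrow> 'f::finite) \<Rightarrow> complex^'a^'a" where
  "P_mat face = M_hat face ** transpose (M_hat face)"

definition U_mat ::
  "('v::finite, 'a::finite) pre_digraph \<Rightarrow> ('a \<Rightarrow> 'f::finite) \<Rightarrow> complex^'a^'a" where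
  "U_mat G face = (2 *\<^sub>R P_mat face - mat 1) ** (2 *\<^sub>R Q_mat G - mat 1)"

text \<open>The operation \<open>^\<close> on vectors of vectors is not used, as it acts componentwise.\<close>

primrec mat_power :: "complex^'n^'n \<Rightarrow> nat \<Rightarrow> complex^'n^'n" where
  "mat_power A 0 = mat 1"
| "mat_power A (Suc n) = A ** mat_power A n"

definition perfect_state_transfer ::
  "('v::finite, 'a::finite) pre_digraph \<Rightarrow> ('a \<Rightarrow> 'f::finite) \<Rightarrow> 'v \<Rightarrow> 'v \<Rightarrow> nat \<Rightarrow> bool" where
  "perfect_state_transfer G face u v \<tau> \<longleftrightarrow>
     u \<noteq> v \<and> \<tau> > 0 \<and>
     mat_power (U_mat G face) \<tau> *v (N_hat G *v axis u 1) = N_hat G *v axis v 1"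

definition periodic_at_vertex ::
  "('v::finite, 'a::finite) pre_digraph \<Rightarrow> ('a \<Rightarrow> 'f::finite) \<Rightarrow> 'v \<Rightarrow> nat \<Rightarrow> bool" where
  "periodic_at_vertex G face u \<tau> \<longleftrightarrow>
     \<tau> > 0 \<and> mat_power (U_mat G face) \<tau> *v (N_hat G *v axis u 1) = N_hat G *v axis u 1"

definition periodic_map ::
  "('v::finite, 'a::finite) pre_digraph \<Rightarrow> ('a \<Rightarrow> 'f::finite) \<Rightarrow> nat \<Rightarrow> bool" where
  "periodic_map G face \<tau> \<longleftrightarrow>
     \<tau> > 0 \<and> mat_power (U_mat G face) \<tau> ** N_hat G = N_hat G"

end

theory Submission
  imports Defs
begin

text \<open>
  Write \<open>N\<close>, \<open>M\<close> for the normalized tail and face matrices, \<open>K = N\<^sup>T M\<close> and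
  \<open>W\<^sub>n = N\<^sup>T U\<^sup>n N\<close>. As \<open>U\<close> is a product of two reflections, \<open>W\<^sub>n\<close> is the \<open>n\<close>-th Chebyshev
  polynomial of \<open>2 K K\<^sup>T - I\<close>. The entries of \<open>K\<close> are normalized numbers of flags shared by a
  vertex and a face, so that \<open>W\<^sub>n\<close> is invariant under all automorphisms, including those that
  reverse the orientation and hence do not act on the arcs. Since \<open>U\<close> is an isometry, transfer
  from \<open>x\<close> to \<open>y\<close> at time \<open>n\<close> means that the \<open>(y, x)\<close> entry of \<open>W\<^sub>n\<close> is 1, so transfer and
  periodicity at one vertex are carried to every vertex. The reflection fixing the range of \<open>N\<close>
  inverts \<open>U\<close>, so transfer from \<open>u\<close> to \<open>v\<close> implies transfer from \<open>v\<close> to \<open>u\<close>.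
\<close>

section \<open>Matrices\<close>

lemma matrix_diff_ldistrib: "A ** (B - C) = A ** B - A ** C"
  for A :: "'r::ring_1^'n^'m"
  by (simp add: vec_eq_iff matrix_matrix_mult_def sum_subtractf right_diff_distrib)

lemma matrix_diff_rdistrib: "(A - B) ** C = A ** C - B ** C"
  for A :: "'r::ring_1^'n^'m"
  by (simp add: vec_eq_iff matrix_matrix_mult_def sum_subtractf left_diff_distrib)

lemma matrix_scaleR_left: "(c *\<^sub>R A) ** B = c *\<^sub>R (A ** B)"
  for A :: "'r::real_algebra_1^'n^'m"
  by (simp add: scalar_matrix_assoc)

lemma matrix_scaleR_right: "A ** (c *\<^sub>R B) = c *\<^sub>R (A ** B)"
  for A :: "'r::real_algebra_1^'n^'m"
  by (simp add: matrix_scalar_ac scalar_matrix_assoc)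

lemma matrix_mul_zero_right [simp]: "A ** 0 = 0"
  by (simp add: vec_eq_iff matrix_matrix_mult_def)

lemma transpose_diff: "transpose (A - B) = transpose A - transpose B"
  by (simp add: transpose_def vec_eq_iff)

lemmas matrix_expand =
  matrix_diff_ldistrib matrix_diff_rdistrib matrix_scaleR_left matrix_scaleR_right

lemma matrix_vector_mul_axis: "(A *v axis j 1) $ i = A $ i $ j"
  for A :: "'r::comm_semiring_1^'n^'m"
  by (simp add: matrix_vector_mult_def axis_def if_distrib cong: if_cong)

lemma mat_power_Suc2: "mat_power A (Suc n) = mat_power A n ** A"
  by (induction n) (simp_all add: matrix_mul_assoc)

lemma mat_power_add: "mat_power A (m + n) = mat_power A m ** mat_power A n"
  by (induction m) (simp_all add: matrix_mul_assoc)

lemma mat_power_commute: "A ** mat_power A n = mat_power A n ** A"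
  by (metis mat_power.simps(2) mat_power_Suc2)

text \<open>The inner product on complex vectors is the real one and \<open>transpose\<close> does
  not conjugate, so the transpose is the adjoint only for matrices with real entries.\<close>

definition real_matrix :: "complex^'n^'m \<Rightarrow> bool" where
  "real_matrix A \<longleftrightarrow> (\<forall>i j. A $ i $ j \<in> \<real>)"

lemma real_matrix_mult: "real_matrix A \<Longrightarrow> real_matrix B \<Longrightarrow> real_matrix (A ** B)"
  by (auto simp: real_matrix_def matrix_matrix_mult_def intro!: sum_in_Reals)

lemma real_matrix_transpose: "real_matrix A \<Longrightarrow> real_matrix (transpose A)"
  by (simp add: real_matrix_def transpose_def)

lemma real_matrix_mat1: "real_matrix (mat 1)"
  by (simp add: real_matrix_def mat_def)

lemma real_matrix_diff: "real_matrix A \<Longrightarrow> real_matrix B \<Longrightarrow> real_matrix (A - B)"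
  by (simp add: real_matrix_def)

lemma real_matrix_scaleR: "real_matrix A \<Longrightarrow> real_matrix (c *\<^sub>R A)"
  by (simp add: real_matrix_def scaleR_conv_of_real[where 'a=complex])

lemma inner_real_matrix:
  fixes A :: "complex^'n^'m"
  assumes "real_matrix A"
  shows "(A *v x) \<bullet> y = x \<bullet> (transpose A *v y)"
proof -
  have *: "(c * z) \<bullet> w = z \<bullet> (c * w)" if "c \<in> \<real>" for c z w :: complex
    using that by (auto elim!: Reals_cases simp: inner_complex_def algebra_simps)
  have "(A *v x) \<bullet> y = (\<Sum>i\<in>UNIV. \<Sum>j\<in>UNIV. (A $ i $ j * x $ j) \<bullet> y $ i)"
    by (simp add: inner_vec_def matrix_vector_mult_def inner_sum_left)
  also have "\<dots> = (\<Sum>i\<in>UNIV. \<Sum>j\<in>UNIV. x $ j \<bullet> (A $ i $ j * y $ i))"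
    using assms by (simp add: * real_matrix_def)
  also have "\<dots> = (\<Sum>j\<in>UNIV. \<Sum>i\<in>UNIV. x $ j \<bullet> (A $ i $ j * y $ i))"
    by (rule sum.swap)
  also have "\<dots> = x \<bullet> (transpose A *v y)"
    by (simp only: inner_vec_def matrix_vector_mult_def transpose_def inner_sum_right vec_lambda_beta)
  finally show ?thesis .
qed

lemma reflection_involution:
  fixes P :: "complex^'n^'n"
  assumes "P ** P = P"
  shows "(2 *\<^sub>R P - mat 1) ** (2 *\<^sub>R P - mat 1) = mat 1"
  by (simp only: matrix_expand assms matrix_mul_lid matrix_mul_rid) (simp add: scaleR_2)

lemma norm_reflection:
  assumes "R ** R = mat 1" and "transpose R = R" and "real_matrix R"
  shows "norm (R *v x) = norm x"
  by (metis assms inner_real_matrix matrix_vector_mul_assoc matrix_vector_mul_lid norm_eq)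


section \<open>Products of two reflections\<close>

text \<open>Collects what can be said about the walk without the map. In the application the rows
  belong to arcs, the columns to vertices and faces.\<close>

locale isometry_pair =
  fixes N :: "complex^'v^'a" and M :: "complex^'f^'a"
  assumes N_isometry: "transpose N ** N = mat 1"
    and M_isometry: "transpose M ** M = mat 1"
    and N_real: "real_matrix N"
    and M_real: "real_matrix M"
begin

definition "Q = N ** transpose N"
definition "P = M ** transpose M"
definition "S = 2 *\<^sub>R Q - mat 1"
definition "R = 2 *\<^sub>R P - mat 1"
definition "U = R ** S"
definition "K = transpose N ** M"
definition "B = transpose N ** (R ** N)"
definition "W n = transpose N ** (mat_power U n ** N)"

section \<open>Projections, reflections and time reversal\<close>

lemma Q_N: "Q ** N = N"
  by (simp add: Q_def matrix_mul_assoc[symmetric] N_isometry)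

lemma Q_idem: "Q ** Q = Q"
  unfolding Q_def by (metis Q_N Q_def matrix_mul_assoc)

lemma P_idem: "P ** P = P"
  unfolding P_def by (metis M_isometry matrix_mul_assoc matrix_mul_rid)

lemma S_S: "S ** S = mat 1"
  unfolding S_def by (rule reflection_involution[OF Q_idem])

lemma R_R: "R ** R = mat 1"
  unfolding R_def by (rule reflection_involution[OF P_idem])

lemma S_N: "S ** N = N"
  by (simp only: S_def matrix_expand Q_N matrix_mul_lid) (simp add: scaleR_2)

lemma norm_U: "norm (U *v x) = norm x"
proof -
  have "norm (S *v x) = norm x" for x
    by (rule norm_reflection[OF S_S])
      (simp_all add: S_def Q_def transpose_diff transpose_scalar matrix_transpose_mul N_real
        real_matrix_diff real_matrix_scaleR real_matrix_mult real_matrix_transpose real_matrix_mat1)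
  moreover have "norm (R *v x) = norm x" for x
    by (rule norm_reflection[OF R_R])
      (simp_all add: R_def P_def transpose_diff transpose_scalar matrix_transpose_mul M_real
        real_matrix_diff real_matrix_scaleR real_matrix_mult real_matrix_transpose real_matrix_mat1)
  ultimately show ?thesis
    by (simp add: U_def matrix_vector_mul_assoc[symmetric])
qed

lemma norm_mat_power_U: "norm (mat_power U n *v x) = norm x"
  by (induction n) (simp_all add: matrix_vector_mul_assoc[symmetric] norm_U)

lemma norm_N: "norm (N *v x) = norm x"
  by (metis N_isometry N_real inner_real_matrix matrix_vector_mul_assoc matrix_vector_mul_lid norm_eq)

lemma N_inject: "N *v x = N *v y \<Longrightarrow> x = y"
  by (metis N_isometry matrix_vector_mul_assoc matrix_vector_mul_lid)

text \<open>Since \<open>U = R S\<close> with involutions \<open>R\<close> and \<open>S\<close>, we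
  have \<open>U S U = S\<close>; this identity is nested \<open>n\<close> times.\<close>

lemma mat_power_U_reverse: "mat_power U n ** (S ** mat_power U n) = S"
proof (induction n)
  case (Suc n)
  have "U ** (S ** U) = S"
    by (metis R_R S_S U_def matrix_mul_assoc matrix_mul_lid)
  then have "mat_power U (Suc n) ** (S ** mat_power U (Suc n)) =
      mat_power U n ** (S ** mat_power U n)"
    by (simp only: mat_power_Suc2[of U n, symmetric] mat_power.simps mat_power_Suc2)
      (metis Suc.IH mat_power_commute matrix_mul_assoc)
  then show ?case using Suc.IH by simp
qed simp

text \<open>\<open>S\<close> fixes both \<open>N *v x\<close> and \<open>N *v y\<close>, so applying
  \<open>mat_power_U_reverse\<close> to \<open>N *v x\<close> gives the claim.\<close>

lemma transfer_symmetric: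
  assumes "mat_power U n *v (N *v x) = N *v y"
  shows "mat_power U n *v (N *v y) = N *v x"
  by (metis S_N assms mat_power_U_reverse matrix_vector_mul_assoc)

text \<open>The source of the Chebyshev recurrence: \<open>U N = R N\<close>, which \<open>S\<close>
  sends to \<open>2 N B - R N\<close>; applying \<open>R\<close> turns these terms into
  \<open>2 U N B\<close> and \<open>N\<close>.\<close>

lemma U_U_N: "U ** (U ** N) = 2 *\<^sub>R (U ** (N ** B)) - N"
proof -
  have UN: "U ** (N ** C) = R ** (N ** C)" for C :: "complex^'v^'v"
    by (metis S_N U_def matrix_mul_assoc)
  have "S ** (R ** N) = 2 *\<^sub>R (N ** B) - R ** N"
    by (simp add: S_def Q_def B_def matrix_expand matrix_mul_assoc)
  moreover have "U ** N = R ** N"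
    using UN[of "mat 1"] by simp
  moreover have "R ** (R ** N) = N"
    by (simp add: matrix_mul_assoc R_R)
  ultimately show ?thesis
    by (simp add: UN U_def matrix_mul_assoc[symmetric] matrix_expand)
      (simp add: UN[unfolded U_def, simplified matrix_mul_assoc[symmetric]])
qed

section \<open>Chebyshev recurrence and symmetries of \<open>W\<close>\<close>

lemma W_0: "W 0 = mat 1"
  by (simp add: W_def N_isometry)

lemma W_1: "W (Suc 0) = B"
  by (simp add: W_def B_def U_def matrix_mul_assoc[symmetric] S_N)

lemma W_Suc_Suc: "W (Suc (Suc n)) = 2 *\<^sub>R (W (Suc n) ** B) - W n"
proof -
  have "mat_power U (Suc (Suc n)) ** N = mat_power U n ** (U ** (U ** N))"
    by (simp only: mat_power_Suc2[of U n] mat_power_Suc2[of U "Suc n"] matrix_mul_assoc)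
  also have "\<dots> = 2 *\<^sub>R (mat_power U (Suc n) ** (N ** B)) - mat_power U n ** N"
    unfolding U_U_N by (simp only: matrix_expand mat_power_Suc2 matrix_mul_assoc)
  finally show ?thesis
    by (simp only: W_def matrix_expand matrix_mul_assoc[symmetric])
qed

lemma B_eq: "B = 2 *\<^sub>R (K ** transpose K) - mat 1"
  by (simp add: B_def R_def P_def K_def matrix_expand matrix_transpose_mul N_isometry matrix_mul_assoc)

text \<open>The symmetry passes from \<open>K\<close> to \<open>B\<close> by reindexing the sum over
  columns of \<open>K\<close> along \<rho>, and from \<open>B\<close> to all \<open>W n\<close>
  through the recurrence, reindexing along \<sigma>.\<close>

lemma W_invariant:
  assumes "bij \<sigma>" and "bij \<rho>" and K: "\<And>x f. K $ \<sigma> x $ \<rho> f = K $ x $ f"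
  shows "W n $ \<sigma> x $ \<sigma> y = W n $ x $ y"
proof -
  have "(K ** transpose K) $ \<sigma> x $ \<sigma> y = (K ** transpose K) $ x $ y" for x y
    by (simp add: matrix_matrix_mult_def transpose_def K
        sum.reindex_bij_betw[OF \<open>bij \<rho>\<close>, of "\<lambda>f. K $ \<sigma> x $ f * K $ \<sigma> y $ f", symmetric])
  then have B: "B $ \<sigma> x $ \<sigma> y = B $ x $ y" for x y
    using \<open>bij \<sigma>\<close> by (simp add: B_eq mat_def inj_eq[OF bij_is_inj])
  show ?thesis
  proof (induction n arbitrary: x y rule: induct_nat_012)
    case 0
    then show ?case
      using \<open>bij \<sigma>\<close> by (simp add: W_0 mat_def inj_eq[OF bij_is_inj])
  next
    case 1
    then show ?case
      using B by (simp add: W_1)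
  next
    case (ge2 n)
    have "(W (Suc n) ** B) $ \<sigma> x $ \<sigma> y = (W (Suc n) ** B) $ x $ y"
      by (simp add: matrix_matrix_mult_def ge2 B
          sum.reindex_bij_betw[OF \<open>bij \<sigma>\<close>, of "\<lambda>z. W (Suc n) $ \<sigma> x $ z * B $ z $ \<sigma> y", symmetric])
    with ge2 show ?case
      by (simp only: W_Suc_Suc vector_minus_component vector_scaleR_component)
  qed
qed

text \<open>Unit vectors with inner product 1 are equal.\<close>

lemma transfer_iff_W:
  "mat_power U n *v (N *v axis x 1) = N *v axis y 1 \<longleftrightarrow> W n $ y $ x = 1"
proof -
  define p q where "p = mat_power U n *v (N *v axis x 1)" and "q = N *v axis y (1::complex)"
  have W: "W n $ y $ x = (transpose N *v p) $ y"
    by (simp only: p_def W_def matrix_vector_mul_axis[symmetric] matrix_vector_mul_assoc)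
  show ?thesis
  proof
    assume "mat_power U n *v (N *v axis x 1) = N *v axis y 1"
    then have "transpose N *v p = axis y 1"
      by (metis N_isometry matrix_vector_mul_assoc matrix_vector_mul_lid p_def)
    then show "W n $ y $ x = 1"
      by (simp only: W axis_nth)
  next
    assume "W n $ y $ x = 1"
    \<comment> \<open>Moving \<open>N\<close> across the inner product leaves the real part of the
      \<open>(y, x)\<close> entry of \<open>W n\<close>.\<close>
    then have "q \<bullet> p = 1"
      by (simp only: q_def inner_real_matrix[OF N_real] W[symmetric] inner_axis')
         (simp add: inner_complex_def)
    moreover have "norm p = 1" "norm q = 1"
      by (simp_all add: p_def q_def norm_mat_power_U norm_N)
    ultimately have "(p - q) \<bullet> (p - q) = 0"
      by (simp add: inner_diff inner_commute norm_eq_1)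
    then show "mat_power U n *v (N *v axis x 1) = N *v axis y 1"
      by (simp add: p_def q_def)
  qed
qed

text \<open>
  On the orthogonal complement of the ranges of \<open>N\<close> and \<open>U N\<close>, the operator \<open>U\<close> is an
  involution. In terms of \<open>X = U\<^sup>2\<^sup>k - I\<close>, this reads \<open>X U\<^sup>2 = X\<close>; hence \<open>X\<^sup>2 = 0\<close>, and \<open>X = 0\<close>
  because \<open>U\<close> is an isometry.
\<close>

lemma mat_power_U_even_eq_1:
  assumes "mat_power U (2 * k) ** N = N"
  shows "mat_power U (2 * k) = mat 1"
proof -
  define Z where "Z = mat_power U (2 * k)"
  define X where "X = Z - mat 1"
  have XQ: "X ** Q = 0"
    using assms by (simp add: X_def Z_def Q_def matrix_expand matrix_mul_assoc)
  have "X ** U = U ** X"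
    by (simp add: X_def Z_def matrix_expand mat_power_commute)
  then have "X ** (U ** Q) = 0"
    by (metis XQ matrix_mul_assoc matrix_mul_zero_right)
  moreover have "U ** Q = 2 *\<^sub>R (P ** Q) - Q"
    by (simp only: U_def R_def S_def matrix_expand Q_idem matrix_mul_assoc[symmetric]
        matrix_mul_lid matrix_mul_rid) (simp add: scaleR_2)
  ultimately have XPQ: "X ** (P ** Q) = 0"
    by (simp add: matrix_expand XQ)
  \<comment> \<open>After \<open>X\<close>, all terms ending in \<open>Q\<close> vanish, so
    \<open>U\<close> acts like the involution \<open>I - 2 P\<close>.\<close>
  have XU: "X ** U = X - 2 *\<^sub>R (X ** P)"
    by (simp add: U_def R_def S_def matrix_expand XQ XPQ)
  have "P ** U = 2 *\<^sub>R (P ** Q) - P"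
    by (simp only: U_def R_def S_def matrix_expand matrix_mul_assoc P_idem
        matrix_mul_lid matrix_mul_rid) (simp add: scaleR_2)
  then have "X ** P ** U = - (X ** P)"
    by (simp add: matrix_mul_assoc[symmetric] matrix_expand XPQ)
  then have XUU: "X ** U ** U = X"
    by (simp add: XU matrix_expand)
  have "X ** mat_power U (2 * j) = X" for j
    by (induction j) (simp_all add: matrix_mul_assoc XUU)
  then have "X ** Z = X"
    by (simp add: Z_def)
  then have XX: "X ** X = 0"
    by (simp add: X_def matrix_expand)
  \<comment> \<open>The isometry \<open>Z = I + X\<close> sends \<open>y\<close> to
    \<open>y + x\<close> and \<open>y + x\<close> to \<open>y + 2 x\<close>. Three equally spaced
    points on a line have equal norms only if \<open>x = 0\<close>.\<close>
  have "X *v y = 0" for y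
  proof -
    define x where "x = X *v y"
    have Zy: "Z *v w = w + X *v w" for w
      by (simp add: X_def algebra_simps)
    have "X *v x = 0"
      by (simp add: x_def matrix_vector_mul_assoc XX)
    then have "Z *v (y + x) = y + x + x"
      by (simp add: Zy x_def algebra_simps)
    then have "norm (y + x + x) = norm (y + x)"
      by (metis Z_def norm_mat_power_U)
    moreover have "norm (y + x) = norm y"
      by (metis Z_def norm_mat_power_U Zy x_def)
    ultimately have "(y + x + x) \<bullet> (y + x + x) = (y + x) \<bullet> (y + x)" "(y + x) \<bullet> (y + x) = y \<bullet> y"
      by (simp_all only: norm_eq)
    then have "x \<bullet> x = 0"
      unfolding inner_add_left inner_add_right inner_commute[of x y] by linarith
    then show ?thesis
      by (simp add: x_def)
  qed
  then have "X = 0"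
    by (simp add: matrix_eq)
  then show ?thesis
    by (simp add: X_def Z_def)
qed

end


section \<open>Fibre matrices\<close>

text \<open>The common form of \<open>tail_matrix\<close> and \<open>face_matrix\<close>, so that
  one computation serves both.\<close>

definition fibre_matrix :: "('a::finite \<Rightarrow> 'i::finite) \<Rightarrow> complex^'i^'a" where
  "fibre_matrix g = (\<chi> a i. if i = g a then 1 else 0)"

definition fibre_weight :: "('a::finite \<Rightarrow> 'i::finite) \<Rightarrow> 'i \<Rightarrow> real" where
  "fibre_weight g i = 1 / sqrt (real (card {a. g a = i}))"

lemma fibre_matrix_nth: "fibre_matrix g $ a $ i = (if i = g a then 1 else 0)"
  by (simp add: fibre_matrix_def)

lemma fibre_matrix_mult:
  "(transpose (fibre_matrix g) ** fibre_matrix h) $ i $ j = of_nat (card {a. g a = i \<and> h a = j})"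
proof -
  have "(transpose (fibre_matrix g) ** fibre_matrix h) $ i $ j
      = (\<Sum>a\<in>UNIV. if g a = i \<and> h a = j then 1 else 0)"
    unfolding matrix_matrix_mult_def transpose_def fibre_matrix_def
    by (simp, rule sum.cong) auto
  also have "\<dots> = of_nat (card {a. g a = i \<and> h a = j})"
    by (simp add: sum.If_cases)
  finally show ?thesis .
qed

lemma normalize_columns_fibre_matrix:
  "normalize_columns (fibre_matrix g) $ a $ i = fibre_matrix g $ a $ i * of_real (fibre_weight g i)"
proof -
  have "csqrt (of_nat n) = of_real (sqrt (real n))" for n
    by (metis csqrt_of_real of_nat_0_le_iff of_real_of_nat_eq)
  then show ?thesis
    by (simp add: normalize_columns_def diag_inv_sqrt_def matrix_matrix_mult_def[of "fibre_matrix g"]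
        fibre_matrix_mult fibre_weight_def if_distrib cong: if_cong)
qed

text \<open>With \<open>h = g\<close> this yields orthonormality of the columns; with the tail and
  face maps it yields the entries of \<open>K\<close>.\<close>

lemma normalize_columns_fibre_matrix_mult:
  "(transpose (normalize_columns (fibre_matrix g)) ** normalize_columns (fibre_matrix h)) $ i $ j =
     of_real (real (card {a. g a = i \<and> h a = j}) * fibre_weight g i * fibre_weight h j)"
proof -
  have "(transpose (normalize_columns (fibre_matrix g)) ** normalize_columns (fibre_matrix h)) $ i $ j
     = (transpose (fibre_matrix g) ** fibre_matrix h) $ i $ j
        * (of_real (fibre_weight g i) * of_real (fibre_weight h j))"
    by (simp add: matrix_matrix_mult_def transpose_def normalize_columns_fibre_matrix
        sum_distrib_right sum_distrib_left mult_ac)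
  then show ?thesis
    by (simp add: fibre_matrix_mult mult_ac)
qed

lemma fibre_weight_pos:
  assumes "surj g"
  shows "fibre_weight g i > 0"
proof -
  have "{a. g a = i} \<noteq> {}"
    using surjD[OF assms, of i] by auto
  then show ?thesis
    by (simp add: fibre_weight_def card_gt_0_iff)
qed

lemma normalize_columns_fibre_matrix_isometry:
  assumes "surj g"
  shows "transpose (normalize_columns (fibre_matrix g)) ** normalize_columns (fibre_matrix g) = mat 1"
proof -
  have "{a. g a = i} \<noteq> {}" for i
    using surjD[OF assms, of i] by auto
  then have "real (card {a. g a = i}) * fibre_weight g i * fibre_weight g i = 1" for i
    by (simp add: fibre_weight_def card_gt_0_iff field_simps)
  moreover have "{a. g a = i \<and> g a = j} = (if i = j then {a. g a = i} else {})" for i j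
    by auto
  ultimately show ?thesis
    by (simp add: vec_eq_iff normalize_columns_fibre_matrix_mult mat_def del: of_real_mult)
qed

lemma real_normalize_columns_fibre_matrix: "real_matrix (normalize_columns (fibre_matrix g))"
  by (simp add: real_matrix_def normalize_columns_fibre_matrix fibre_matrix_nth)

lemma isometry_pair_fibre_matrix:
  assumes "surj g" and "surj h"
  shows "isometry_pair (normalize_columns (fibre_matrix g)) (normalize_columns (fibre_matrix h))"
  using assms
  by unfold_locales
    (simp_all add: normalize_columns_fibre_matrix_isometry real_normalize_columns_fibre_matrix)


section \<open>Orientable maps\<close>

context orientable_map
begin

lemma out_arcs_eq: "out_arcs G x = {a. tail G a = x}"
  by (auto simp: out_arcs_def arcs_UNIV)

lemma surj_tail: "surj (tail G)"
proof -
  have "\<exists>a. tail G a = x" for x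
  proof -
    \<comment> \<open>The empty set is not \<open>cyclic_on\<close>, so no vertex is
      isolated.\<close>
    have "out_arcs G x \<noteq> {}"
      using cyclic_rot[of x] by (auto simp: cyclic_on_def)
    then show ?thesis
      by (auto simp: out_arcs_eq)
  qed
  then show ?thesis
    by (metis surjI)
qed

lemma tail_rot: "tail G (rot a) = tail G a"
  using cyclic_on_inI[OF cyclic_rot[of "tail G a"], of a] by (simp add: out_arcs_eq)

text \<open>As \<open>arev\<close> is an involution, \<open>rot a\<close> is the successor of
  \<open>arev a\<close> on its facial walk.\<close>

lemma face_rot: "face (rot a) = face (arev a)"
  unfolding face_eq_iff using orbit.base[of "rot \<circ> arev" "arev a"] by simp

lemma inj_rot: "inj rot"
proof -
  have "a \<in> range rot" for a
  proof -
    \<comment> \<open>An \<open>orbit\<close> starts at the image \<open>rot a\<close>, not at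
      \<open>a\<close>; so membership exhibits \<open>a\<close> as a value of
      \<open>rot\<close>.\<close>
    have "a \<in> orbit rot a"
      using cyclic_rot[of "tail G a"] by (auto simp: cyclic_on_alldef out_arcs_eq)
    then show ?thesis
      by cases auto
  qed
  then show ?thesis
    by (intro finite_UNIV_surj_inj) auto
qed

text \<open>
  The flags \<open>(a, arev a)\<close> are as numerous as the clockwise ones \<open>(a, a)\<close>, because \<open>arev a\<close> lies in
  the same face as \<open>rot a\<close>.
\<close>

lemma card_vertex_face_flags:
  "card {x \<in> flags arev. flag_vertex G x = w \<and> flag_face face x = f} =
     2 * card {a. tail G a = w \<and> face a = f}"
proof -
  let ?A = "{a. tail G a = w \<and> face a = f}" and ?B = "{a. tail G a = w \<and> face (arev a) = f}"
  have "rot ` ?B = ?A"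
  proof -
    have "a \<in> rot ` ?B" if "a \<in> ?A" for a
    proof -
      obtain b where "a = rot b"
        using inj_rot by (metis finite_UNIV_inj_surj finite surjD)
      with that show ?thesis
        by (auto simp: tail_rot face_rot)
    qed
    then show ?thesis
      by (auto simp: tail_rot face_rot)
  qed
  then have card_B: "card ?B = card ?A"
    using card_image[OF inj_on_subset[OF inj_rot subset_UNIV], of ?B] by simp
  have "{x \<in> flags arev. flag_vertex G x = w \<and> flag_face face x = f} =
      (\<lambda>a. (a, a)) ` ?A \<union> (\<lambda>a. (a, arev a)) ` ?B"
    by (auto simp: flags_def arc_edge_def flag_vertex_def flag_face_def)
  moreover have "(\<lambda>a. (a, a)) ` ?A \<inter> (\<lambda>a. (a, arev a)) ` ?B = {}"
    by auto (metis arev_neq arcs_UNIV UNIV_I)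
  ultimately show ?thesis
    by (simp add: card_Un_disjoint card_image inj_on_def card_B)
qed

text \<open>A reversal of orientation does not preserve the clockwise flags, but every automorphism
  permutes all flags. The count for flags is twice the one for arcs.\<close>

lemma card_vertex_face_automorphism:
  assumes "map_automorphism G arev face \<phi> \<phi>V \<phi>E \<phi>F"
  shows "card {a. tail G a = \<phi>V w \<and> face a = \<phi>F f} = card {a. tail G a = w \<and> face a = f}"
proof -
  let ?flags = "\<lambda>w f. {x \<in> flags arev. flag_vertex G x = w \<and> flag_face face x = f}"
  have \<phi>: "\<phi> permutes flags arev" and inj: "inj \<phi>V" "inj \<phi>F"
    and inc: "\<And>x. x \<in> flags arev \<Longrightarrow> flag_vertex G (\<phi> x) = \<phi>V (flag_vertex G x)"
      "\<And>x. x \<in> flags arev \<Longrightarrow> flag_face face (\<phi> x) = \<phi>F (flag_face face x)"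
    using assms by (auto simp: map_automorphism_def permutes_inj)
  have sup: "y \<in> \<phi> ` ?flags w f" if "y \<in> ?flags (\<phi>V w) (\<phi>F f)" for y
  proof -
    have "y \<in> \<phi> ` flags arev"
      using that by (simp add: permutes_image[OF \<phi>])
    then obtain x where x: "x \<in> flags arev" "y = \<phi> x"
      by (elim imageE)
    then have "\<phi>V (flag_vertex G x) = \<phi>V w" "\<phi>F (flag_face face x) = \<phi>F f"
      using that by (simp_all add: inc)
    then have "x \<in> ?flags w f"
      using x(1) by (simp add: inj_eq inj)
    with x(2) show ?thesis
      by blast
  qed
  have sub: "\<phi> x \<in> ?flags (\<phi>V w) (\<phi>F f)" if "x \<in> ?flags w f" for x
    using that by (simp add: inc permutes_in_image[OF \<phi>])
  have "\<phi> ` ?flags w f = ?flags (\<phi>V w) (\<phi>F f)"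
    by (intro equalityI image_subsetI subsetI) (erule sub, erule sup)
  then have "card (?flags (\<phi>V w) (\<phi>F f)) = card (?flags w f)"
    using card_image[OF permutes_inj_on[OF \<phi>], of "?flags w f"] by (simp only:)
  then show ?thesis
    by (simp add: card_vertex_face_flags)
qed

section \<open>The walk of a map and its automorphisms\<close>

lemma N_hat_eq: "N_hat G = normalize_columns (fibre_matrix (tail G))"
  by (simp add: tail_matrix_def fibre_matrix_def)

lemma M_hat_eq: "M_hat face = normalize_columns (fibre_matrix face)"
  by (simp add: face_matrix_def fibre_matrix_def)

sublocale walk: isometry_pair "N_hat G" "M_hat face"
  unfolding N_hat_eq M_hat_eq by (rule isometry_pair_fibre_matrix[OF surj_tail surj_face])

lemma walk_U: "walk.U = U_mat G face"
  by (simp only: walk.U_def walk.R_def walk.S_def walk.P_def walk.Q_def U_mat_def P_mat_def Q_mat_def)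

lemma walk_K:
  "walk.K $ w $ f = of_real (real (card {a. tail G a = w \<and> face a = f}) *
     fibre_weight (tail G) w * fibre_weight face f)"
  unfolding walk.K_def unfolding N_hat_eq M_hat_eq by (rule normalize_columns_fibre_matrix_mult)

lemma walk_W_automorphism:
  assumes "map_automorphism G arev face \<phi> \<phi>V \<phi>E \<phi>F"
  shows "walk.W n $ \<phi>V x $ \<phi>V y = walk.W n $ x $ y"
proof -
  note card_eq = card_vertex_face_automorphism[OF assms]
  have bij: "bij \<phi>V" "bij \<phi>F"
    using assms surj_face verts_UNIV by (auto simp: map_automorphism_def permutes_bij)
  \<comment> \<open>Degrees of vertices and faces are sums of the invariant counts, so the
    normalizing weights in \<open>K\<close> are invariant as well.\<close>
  have tail_card: "card {a. tail G a = w} = (\<Sum>f\<in>UNIV. card {a. tail G a = w \<and> face a = f})" for w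
    by (subst card_UN_disjoint[symmetric]) (auto intro!: arg_cong[of _ _ card])
  have face_card: "card {a. face a = f} = (\<Sum>w\<in>UNIV. card {a. tail G a = w \<and> face a = f})" for f
    by (subst card_UN_disjoint[symmetric]) (auto intro!: arg_cong[of _ _ card])
  have "card {a. tail G a = \<phi>V w} = card {a. tail G a = w}" for w
    using sum.reindex_bij_betw[OF bij(2), of "\<lambda>f. card {a. tail G a = \<phi>V w \<and> face a = f}"]
    by (simp add: tail_card card_eq)
  moreover have "card {a. face a = \<phi>F f} = card {a. face a = f}" for f
    using sum.reindex_bij_betw[OF bij(1), of "\<lambda>w. card {a. tail G a = w \<and> face a = \<phi>F f}"]
    by (simp add: face_card card_eq)
  ultimately have "walk.K $ \<phi>V w $ \<phi>F f = walk.K $ w $ f" for w f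
    by (simp add: walk_K card_eq fibre_weight_def)
  then show ?thesis
    by (rule walk.W_invariant[OF bij])
qed

lemma transfer_automorphism:
  assumes "map_automorphism G arev face \<phi> \<phi>V \<phi>E \<phi>F"
    and "mat_power (U_mat G face) n *v (N_hat G *v axis x 1) = N_hat G *v axis y 1"
  shows "mat_power (U_mat G face) n *v (N_hat G *v axis (\<phi>V x) 1) = N_hat G *v axis (\<phi>V y) 1"
  using assms(2)
  by (simp only: walk_U[symmetric] walk.transfer_iff_W walk_W_automorphism[OF assms(1)])

lemma vertex_transitiveE:
  assumes "vertex_transitive G arev face"
  obtains \<phi> \<phi>V \<phi>E \<phi>F where "map_automorphism G arev face \<phi> \<phi>V \<phi>E \<phi>F" "\<phi>V x = y"
  using assms unfolding vertex_transitive_def verts_UNIV by blast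

section \<open>Periodicity and perfect state transfer\<close>

lemma periodic_mapI:
  assumes "\<tau> > 0"
    and "\<And>x. mat_power (U_mat G face) \<tau> *v (N_hat G *v axis x 1) = N_hat G *v axis x 1"
  shows "periodic_map G face \<tau>"
proof -
  have "(mat_power (U_mat G face) \<tau> ** N_hat G) $ a $ x = N_hat G $ a $ x" for a x
    by (metis assms(2) matrix_vector_mul_assoc matrix_vector_mul_axis)
  with assms(1) show ?thesis
    by (simp add: periodic_map_def vec_eq_iff)
qed

lemma periodic_map_if_periodic_at_vertex:
  assumes "vertex_transitive G arev face" and "periodic_at_vertex G face u \<tau>"
  shows "periodic_map G face \<tau>"
proof (rule periodic_mapI)
  show "\<tau> > 0"
    using assms(2) by (simp add: periodic_at_vertex_def)
next
  fix x
  obtain \<phi> \<phi>V \<phi>E \<phi>F where "map_automorphism G arev face \<phi> \<phi>V \<phi>E \<phi>F" "\<phi>V u = x"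
    using assms(1) by (rule vertex_transitiveE)
  then show "mat_power (U_mat G face) \<tau> *v (N_hat G *v axis x 1) = N_hat G *v axis x 1"
    using transfer_automorphism assms(2) by (metis periodic_at_vertex_def)
qed

lemma perfect_state_transfer_unique:
  assumes "perfect_state_transfer G face x y \<tau>" and "perfect_state_transfer G face x z \<tau>"
  shows "y = z"
proof -
  have "axis y (1::complex) = axis z 1"
    using assms by (intro walk.N_inject) (simp add: perfect_state_transfer_def)
  then show ?thesis
    by (simp add: axis_eq_axis)
qed

lemma perfect_state_transfer_from_each_vertex:
  assumes "vertex_transitive G arev face" and "perfect_state_transfer G face u v \<tau>"
  shows "\<exists>!y. perfect_state_transfer G face x y \<tau>"
proof -
  obtain \<phi> \<phi>V \<phi>E \<phi>F where aut: "map_automorphism G arev face \<phi> \<phi>V \<phi>E \<phi>F" and "\<phi>V u = x"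
    using assms(1) by (rule vertex_transitiveE)
  moreover have "inj \<phi>V"
    using aut by (auto simp: map_automorphism_def permutes_inj)
  ultimately have "perfect_state_transfer G face x (\<phi>V v) \<tau>"
    using assms(2) transfer_automorphism[OF aut]
    by (auto simp: perfect_state_transfer_def inj_eq)
  then show ?thesis
    using perfect_state_transfer_unique by blast
qed

text \<open>Transfer to \<open>v\<close> and back makes \<open>u\<close> periodic at the even time
  \<open>2 * \<tau>\<close>; transitivity spreads this to all vertices.\<close>

lemma perfect_state_transfer_power_eq_1:
  assumes "vertex_transitive G arev face" and "perfect_state_transfer G face u v \<tau>"
  shows "mat_power (U_mat G face) (2 * \<tau>) = mat 1"
proof -
  have "mat_power walk.U \<tau> *v (N_hat G *v axis u 1) = N_hat G *v axis v 1"
    using assms(2) by (simp add: perfect_state_transfer_def walk_U)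
  with walk.transfer_symmetric[OF this]
  have "mat_power walk.U (2 * \<tau>) *v (N_hat G *v axis u 1) = N_hat G *v axis u 1"
    by (simp add: mult_2 mat_power_add matrix_vector_mul_assoc[symmetric])
  then have "periodic_at_vertex G face u (2 * \<tau>)"
    using assms(2) by (simp add: perfect_state_transfer_def periodic_at_vertex_def walk_U)
  then have "periodic_map G face (2 * \<tau>)"
    by (rule periodic_map_if_periodic_at_vertex[OF assms(1)])
  then show ?thesis
    using walk.mat_power_U_even_eq_1 by (simp add: periodic_map_def walk_U)
qed

text \<open>
  Transfer in one step means \<open>2 P N e\<^sub>u = N e\<^sub>u + N e\<^sub>v\<close>. The left-hand side is
  supported on the arcs of the faces at \<open>u\<close>, the right-hand side on the arcs leaving \<open>u\<close> or \<open>v\<close>.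
\<close>

lemma tail_iff_face_if_transfer_1:
  assumes "perfect_state_transfer G face u v 1"
  shows "tail G a \<in> {u, v} \<longleftrightarrow> (\<exists>b. tail G b = u \<and> face b = face a)"
proof -
  have "u \<noteq> v" and "walk.U *v (N_hat G *v axis u 1) = N_hat G *v axis v 1"
    using assms by (simp_all add: perfect_state_transfer_def walk_U)
  moreover have "walk.U ** N_hat G = 2 *\<^sub>R (M_hat face ** transpose walk.K) - N_hat G"
    by (simp only: walk.U_def matrix_mul_assoc[symmetric] walk.S_N)
      (simp only: walk.R_def walk.P_def walk.K_def matrix_expand matrix_transpose_mul
        transpose_transpose matrix_mul_lid matrix_mul_assoc)
  ultimately have "2 *\<^sub>R (M_hat face ** transpose walk.K) $ a $ u - N_hat G $ a $ u = N_hat G $ a $ v"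
    by (metis matrix_vector_mul_assoc matrix_vector_mul_axis vector_minus_component
        vector_scaleR_component)
  moreover have "(M_hat face ** transpose walk.K) $ a $ u = M_hat face $ a $ face a * walk.K $ u $ face a"
    by (simp add: matrix_matrix_mult_def transpose_def M_hat_eq normalize_columns_fibre_matrix
        fibre_matrix_nth if_distrib[of "\<lambda>x. x * _"] cong: if_cong)
  ultimately have "N_hat G $ a $ u + N_hat G $ a $ v \<noteq> 0 \<longleftrightarrow>
      M_hat face $ a $ face a * walk.K $ u $ face a \<noteq> 0"
    by (auto simp: algebra_simps)
  \<comment> \<open>As \<open>u\<close> and \<open>v\<close> differ, at most one of the two entries
    is nonzero and nothing cancels.\<close>
  moreover have "N_hat G $ a $ u + N_hat G $ a $ v \<noteq> 0 \<longleftrightarrow> tail G a \<in> {u, v}"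
    using \<open>u \<noteq> v\<close> fibre_weight_pos[OF surj_tail]
    by (auto simp: N_hat_eq normalize_columns_fibre_matrix fibre_matrix_nth less_imp_neq[symmetric])
  moreover have M_nth: "M_hat face $ a $ face a = of_real (fibre_weight face (face a))"
    by (simp add: M_hat_eq normalize_columns_fibre_matrix fibre_matrix_nth)
  moreover have "M_hat face $ a $ face a * walk.K $ u $ face a \<noteq> 0 \<longleftrightarrow>
      (\<exists>b. tail G b = u \<and> face b = face a)"
    using fibre_weight_pos[OF surj_tail, of u] fibre_weight_pos[OF surj_face, of "face a"]
    by (simp add: walk_K M_nth)
  ultimately show ?thesis
    by blast
qed

text \<open>Whether the tail of an arc is in \<open>{u, v}\<close> depends only on its face. The
  next arc of that face starts at the head, so \<open>{u, v}\<close> is closed under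
  adjacency.\<close>

lemma two_vertices_if_transfer_1:
  assumes "perfect_state_transfer G face u v 1"
  shows "verts G = {u, v}"
proof -
  note tail_iff = tail_iff_face_if_transfer_1[OF assms]
  have step: "head G a \<in> {u, v}" if "tail G a \<in> {u, v}" for a
  proof -
    have "face (rot (arev a)) = face a"
      by (simp add: face_rot)
    then have "tail G (rot (arev a)) \<in> {u, v}"
      using that tail_iff by metis
    then show ?thesis
      by (simp add: tail_rot arcs_UNIV)
  qed
  have "w \<in> {u, v}" for w
  proof -
    \<comment> \<open>\<open>connected\<close> refers to the symmetrization, which has the same
      reachability as the bidirected \<open>G\<close>.\<close>
    have "u \<rightarrow>\<^sup>*\<^bsub>mk_symmetric G\<^esub> w"
      using connected_G verts_UNIV by (auto simp: connected_def strongly_connected_def)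
    then have "u \<rightarrow>\<^sup>*\<^bsub>G\<^esub> w"
      using reachable_mk_symmetric_eq[OF sym_arcs] by simp
    then show ?thesis
    proof (induction rule: reachable_induct)
      case (step x y)
      then show ?case
        using \<open>\<And>a. tail G a \<in> {u, v} \<Longrightarrow> head G a \<in> {u, v}\<close>
        by (auto simp: arcs_ends_def arc_to_ends_def)
    qed simp
  qed
  then show ?thesis
    using verts_UNIV by blast
qed


end

theorem theorem5p5:
  fixes G :: "('v::finite, 'a::finite) pre_digraph"
    and arev rot :: "'a \<Rightarrow> 'a"
    and face :: "'a \<Rightarrow> 'f::finite"
    and u v :: 'v
  assumes "orientable_map G arev rot face"
    and "vertex_transitive G arev face"
    and "u \<in> verts G" and "v \<in> verts G"
  shows "(\<forall>\<tau>. u \<noteq> v \<and> perfect_state_transfer G face u v \<tau> \<longrightarrow>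
            (\<forall>x \<in> verts G. \<exists>!y. y \<in> verts G \<and> perfect_state_transfer G face x y \<tau>) \<and>
            mat_power (U_mat G face) (2 * \<tau>) = mat 1) \<and>
         (\<forall>\<tau>. periodic_at_vertex G face u \<tau> \<longrightarrow> periodic_map G face \<tau>) \<and>
         (u \<noteq> v \<and> perfect_state_transfer G face u v 1 \<longrightarrow> verts G = {u, v})"
proof -
  interpret orientable_map G arev rot face
    by fact
  show ?thesis
    using perfect_state_transfer_from_each_vertex[OF assms(2)]
      perfect_state_transfer_power_eq_1[OF assms(2)]
      periodic_map_if_periodic_at_vertex[OF assms(2)] two_vertices_if_transfer_1
    unfolding verts_UNIV by blast
qed

end
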